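(* Let $\mu$ be a positive finite Borel measure on $[0,1)$ and let $v,w$ be weights on $\mathbb{D}$. Consider: (i) $C(v,w):=\sup_{0\le r<1}w(r)\int_0^1\frac{d\mu(t)}{v(t)(1-tr)}<\infty$; (ii) $I_\mu:H^\infty_v\to H^\infty_w$ is well defined and continuous. Then (i) implies (ii). If in addition $v$ is essential, then (i) and (ii) are equivalent.
   Context: $\mathbb{D}$ is the open unit disc and $H(\mathbb{D})$ the holomorphic functions on $\mathbb{D}$. A weight is a function $v:\mathbb{D}\to(0,\infty)$ that is radial ($v(z)=v(|z|)$), continuous, non-increasing in $|z|$, with $\lim_{r\to1^-}v(r)=0$. $H^\infty_v=\{f\in H(\mathbb{D}):\|f\|_v:=\sup_{z\in\mathbb{D}}v(z)|f(z)|<\infty\}$. A weight $v$ is essential if there is $c>0$ with $c/v(z)\le\sup\{|f(z)|:\|f\|_v\le1\}\le1/v(z)$ for all $z\in\mathbb{D}$. $I_\mu(f)(z)=\int_0^1\frac{f(t)}{1-tz}\,d\mu(t)$ whenever this defines a holomorphic function on $\mathbb{D}$. *)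

theory Defs
  imports "HOL-Analysis.Analysis"
begin

abbreviation unit_disc :: "complex set" where
  "unit_disc \<equiv> ball 0 1"

definition is_weight :: "(complex \<Rightarrow> real) \<Rightarrow> bool" where
  "is_weight v \<longleftrightarrow>
     (\<forall>z\<in>unit_disc. v z > 0) \<and>
     (\<forall>z\<in>unit_disc. v z = v (complex_of_real (norm z))) \<and>
     continuous_on unit_disc v \<and>
     (\<forall>z\<in>unit_disc. \<forall>u\<in>unit_disc. norm z \<le> norm u \<longrightarrow> v u \<le> v z) \<and>
     ((\<lambda>r. v (complex_of_real r)) \<longlongrightarrow> 0) (at_left 1)"

definition in_Hv :: "(complex \<Rightarrow> real) \<Rightarrow> (complex \<Rightarrow> complex) \<Rightarrow> bool" where
  "in_Hv v f \<longleftrightarrow> f holomorphic_on unit_disc \<and>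
     bdd_above ((\<lambda>z. v z * norm (f z)) ` unit_disc)"

definition Hv_norm :: "(complex \<Rightarrow> real) \<Rightarrow> (complex \<Rightarrow> complex) \<Rightarrow> real" where
  "Hv_norm v f = (SUP z\<in>unit_disc. v z * norm (f z))"

definition essential_weight :: "(complex \<Rightarrow> real) \<Rightarrow> bool" where
  "essential_weight v \<longleftrightarrow>
     (\<exists>c>0. \<forall>z\<in>unit_disc.
        c / v z \<le> Sup {norm (f z) | f. in_Hv v f \<and> Hv_norm v f \<le> 1} \<and>
        Sup {norm (f z) | f. in_Hv v f \<and> Hv_norm v f \<le> 1} \<le> 1 / v z)"

text \<open>The operator I_mu (a measure on the reals concentrated on [0,1)).\<close>
definition I_mu :: "real measure \<Rightarrow> (complex \<Rightarrow> complex) \<Rightarrow> complex \<Rightarrow> complex" where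
  "I_mu M f z = (LINT t|M. f (complex_of_real t) / (1 - complex_of_real t * z))"

definition C_vw :: "real measure \<Rightarrow> (complex \<Rightarrow> real) \<Rightarrow> (complex \<Rightarrow> real) \<Rightarrow> ennreal" where
  "C_vw M v w = (SUP r\<in>{0..<1::real}. ennreal (w (complex_of_real r)) *
      (\<integral>\<^sup>+ t. ennreal (1 / (v (complex_of_real t) * (1 - t * r))) \<partial>M))"

text \<open>Condition (ii): I_mu : H^infty_v \<rightarrow> H^infty_w is well defined and continuous
  (i.e. bounded, as it is linear).\<close>
definition I_mu_bounded :: "real measure \<Rightarrow> (complex \<Rightarrow> real) \<Rightarrow> (complex \<Rightarrow> real) \<Rightarrow> bool" where
  "I_mu_bounded M v w \<longleftrightarrow>
     (\<forall>f. in_Hv v f \<longrightarrow>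
        (\<forall>z\<in>unit_disc. integrable M (\<lambda>t. f (complex_of_real t) / (1 - complex_of_real t * z))) \<and>
        in_Hv w (I_mu M f)) \<and>
     (\<exists>C. \<forall>f. in_Hv v f \<longrightarrow> Hv_norm w (I_mu M f) \<le> C * Hv_norm v f)"

end

theory Submission
  imports Defs "HOL-Complex_Analysis.Conformal_Mappings"
begin

text \<open>
  If \<open>C(v,w)\<close> is finite, then \<open>\<bar>f t\<bar> \<le> \<parallel>f\<parallel> / v t\<close> bounds the integral, and expanding the kernel
  into a geometric series exhibits \<open>I_mu f\<close> as a power series.

  For the converse it suffices to find one \<open>F\<close> in \<open>H_v\<close> with \<open>1 / v \<le> Re F\<close> on \<open>[0,1)\<close>, for
  then the integral in \<open>C(v,w)\<close> is at most \<open>Re (I_mu F)\<close>. Let \<open>\<phi> = 1 / v\<close> with \<open>v\<close> essential.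
  The maximum principle for \<open>f z / z^n\<close> on annuli shows that at every radius \<open>r \<ge> 1/2\<close> some
  monomial with natural exponent equals \<open>\<phi>\<close> at \<open>r\<close> and is at most \<open>K \<phi>\<close> on \<open>[1/2,1)\<close>. A greedy
  choice of monomials, in the style of Erdos and Kovari, switches from one to the next only when
  \<open>\<phi>\<close> has finally outgrown the current one; away from its own interval each chosen monomial then
  decays geometrically, so their sum is comparable to \<open>\<phi>\<close>.
\<close>

section \<open>Sums, powers and continuous functions\<close>

lemma sum_le_last_of_doubling:
  fixes a :: "nat \<Rightarrow> real"
  assumes "\<And>j. j < n \<Longrightarrow> 2 * a j \<le> a (Suc j)"
  shows "(\<Sum>j<n. a j) \<le> a n - a 0"
  using assms
proof (induction n)
  case (Suc n)
  have "(\<Sum>j<n. a j) \<le> a n - a 0" by (intro Suc.IH Suc.prems) simp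
  then show ?case using Suc.prems[of n] by simp
qed simp

lemma sum_le_first_of_halving:
  fixes a :: "nat \<Rightarrow> real"
  assumes "\<And>j. j < n \<Longrightarrow> 2 * a (Suc j) \<le> a j"
  shows "(\<Sum>j<n. a j) \<le> 2 * (a 0 - a n)"
  using assms
proof (induction n)
  case (Suc n)
  have "(\<Sum>j<n. a j) \<le> 2 * (a 0 - a n)" by (intro Suc.IH Suc.prems) simp
  then show ?case using Suc.prems[of n] by simp
qed simp

lemma sum_le_of_geometric_peak:
  fixes a :: "nat \<Rightarrow> real"
  assumes nonneg: "\<And>j. 0 \<le> a j"
    and doubling: "\<And>j. Suc j < k \<Longrightarrow> 2 * a j \<le> a (Suc j)"
    and peak: "\<And>j. Suc j = k \<Longrightarrow> a j \<le> a k" "a (Suc k) \<le> a k"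
    and halving: "\<And>j. k < j \<Longrightarrow> 2 * a (Suc j) \<le> a j"
  shows "(\<Sum>j<n. a j) \<le> 5 * a k"
proof -
  have before: "(\<Sum>j<k. a j) \<le> 2 * a k"
  proof (cases k)
    case 0
    then show ?thesis using nonneg[of 0] by simp
  next
    case (Suc l)
    have "(\<Sum>j<l. a j) \<le> a l - a 0"
      using Suc by (intro sum_le_last_of_doubling doubling) simp
    then show ?thesis using Suc peak(1)[of l] nonneg[of 0] by simp
  qed
  have after: "(\<Sum>i<n. a (Suc k + i)) \<le> 2 * a k"
  proof -
    have "(\<Sum>i<n. a (Suc k + i)) \<le> 2 * (a (Suc k + 0) - a (Suc k + n))"
      using halving by (intro sum_le_first_of_halving) simp
    then show ?thesis using peak(2) nonneg[of "Suc k + n"] by simp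
  qed
  have "(\<Sum>j<n. a j) \<le> (\<Sum>j<Suc k + n. a j)"
    by (intro sum_mono2 nonneg) auto
  also have "\<dots> = (\<Sum>j<Suc k. a j) + (\<Sum>i<n. a (Suc k + i))"
    by (induction n) simp_all
  finally show ?thesis using before after by simp
qed

lemma ex_less_mult_power:
  fixes a s :: real
  assumes "0 < a" "1 < s"
  shows "\<exists>n. b < a * s ^ n"
proof -
  obtain n where "b / a < s ^ n" using real_arch_pow[OF assms(2)] by blast
  then show ?thesis using assms(1) by (auto simp: field_simps)
qed

definition critical_exponent :: "(real \<Rightarrow> real) \<Rightarrow> real \<Rightarrow> real \<Rightarrow> nat" where
  "critical_exponent \<psi> a r = (GREATEST n. \<forall>x\<in>{r<..<1}. a * (x / r) ^ n \<le> \<psi> x)"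

context
  fixes \<psi> :: "real \<Rightarrow> real" and a r :: real
  assumes a: "0 < a" and r: "0 < r" "r < 1" and a_le: "\<And>x. x \<in> {r<..<1} \<Longrightarrow> a \<le> \<psi> x"
begin

lemma exponents_below_bounded:
  "\<exists>b. \<forall>n. (\<forall>x\<in>{r<..<1}. a * (x / r) ^ n \<le> \<psi> x) \<longrightarrow> n \<le> b"
proof -
  define y where "y = (r + 1) / 2"
  have y: "y \<in> {r<..<1}" "1 < y / r" using r by (auto simp: y_def)
  obtain b where b: "\<psi> y < a * (y / r) ^ b" using ex_less_mult_power[OF a y(2)] by blast
  have "n \<le> b" if "\<forall>x\<in>{r<..<1}. a * (x / r) ^ n \<le> \<psi> x" for n
  proof -
    have "a * (y / r) ^ n \<le> \<psi> y" using that y(1) by blast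
    also note b
    finally have "(y / r) ^ n < (y / r) ^ b" using a by simp
    then show ?thesis using y(2) by (meson less_imp_le power_less_imp_less_exp)
  qed
  then show ?thesis by blast
qed

lemma mult_power_critical_exponent_le:
  assumes "x \<in> {r<..<1}"
  shows "a * (x / r) ^ critical_exponent \<psi> a r \<le> \<psi> x"
proof -
  have "\<forall>x\<in>{r<..<1}. a * (x / r) ^ 0 \<le> \<psi> x" using a_le by simp
  from GreatestI_nat[where P = "\<lambda>n. \<forall>x\<in>{r<..<1}. a * (x / r) ^ n \<le> \<psi> x", OF this]
  show ?thesis using exponents_below_bounded assms unfolding critical_exponent_def by blast
qed

lemma le_critical_exponent:
  assumes "\<And>x. x \<in> {r<..<1} \<Longrightarrow> a * (x / r) ^ n \<le> \<psi> x"
  shows "n \<le> critical_exponent \<psi> a r"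
  unfolding critical_exponent_def
  using Greatest_le_nat[where P = "\<lambda>n. \<forall>x\<in>{r<..<1}. a * (x / r) ^ n \<le> \<psi> x"]
    exponents_below_bounded assms by blast

lemma less_mult_power_Suc_critical_exponent:
  "\<exists>x\<in>{r<..<1}. \<psi> x < a * (x / r) ^ Suc (critical_exponent \<psi> a r)"
  using le_critical_exponent[of "Suc (critical_exponent \<psi> a r)"] by (meson Suc_n_not_le_n not_le)

end

lemma mult_power_le_below:
  fixes a b p q x y :: real
  assumes "b * (y / q) ^ n \<le> a * (y / p) ^ m" "m \<le> n"
    and "0 \<le> b" "0 \<le> q" "0 \<le> x" "x \<le> y" "0 < y"
  shows "b * (x / q) ^ n \<le> a * (x / p) ^ m"
proof -
  define s where "s = x / y"
  have s: "0 \<le> s" "s \<le> 1" "x = s * y" using assms by (auto simp: s_def)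
  have "b * (x / q) ^ n = s ^ n * (b * (y / q) ^ n)"
    by (simp add: s power_mult_distrib power_divide)
  also have "\<dots> \<le> s ^ m * (b * (y / q) ^ n)"
    using assms s by (intro mult_right_mono power_decreasing) auto
  also have "\<dots> \<le> s ^ m * (a * (y / p) ^ m)"
    using assms s by (intro mult_left_mono) auto
  also have "\<dots> = a * (x / p) ^ m" by (simp add: s power_mult_distrib power_divide)
  finally show ?thesis .
qed

lemma mult_power_le_above:
  fixes a b p q x y :: real
  assumes "a * (y / p) ^ m \<le> b * (y / q) ^ n" "m \<le> n"
    and "0 \<le> b" "0 \<le> q" "0 < y" "y \<le> x"
  shows "a * (x / p) ^ m \<le> b * (x / q) ^ n"
proof -
  define s where "s = x / y"
  have s: "1 \<le> s" "x = s * y" using assms by (auto simp: s_def)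
  have "a * (x / p) ^ m = s ^ m * (a * (y / p) ^ m)"
    by (simp add: s power_mult_distrib power_divide)
  also have "\<dots> \<le> s ^ m * (b * (y / q) ^ n)"
    using assms s by (intro mult_left_mono) auto
  also have "\<dots> \<le> s ^ n * (b * (y / q) ^ n)"
    using assms s by (intro mult_right_mono power_increasing) auto
  also have "\<dots> = b * (x / q) ^ n" by (simp add: s power_mult_distrib power_divide)
  finally show ?thesis .
qed

lemma last_zero_before_positive:
  fixes g :: "real \<Rightarrow> real"
  assumes cont: "continuous_on {a..<b} g" and "a < b" "g a \<le> 0"
    and pos: "eventually (\<lambda>x. 0 < g x) (at_left b)"
  shows "\<exists>q\<in>{a..<b}. g q = 0 \<and> (\<forall>x\<in>{q<..<b}. 0 < g x)"
proof -
  obtain c where c: "c < b" "\<And>x. c < x \<Longrightarrow> x < b \<Longrightarrow> 0 < g x"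
    using pos unfolding eventually_at_left_field by blast
  define d where "d = (max a c + b) / 2"
  have d: "a < d" "c < d" "d < b" using c(1) \<open>a < b\<close> by (auto simp: d_def)
  define S where "S = {x \<in> {a..d}. g x \<le> 0}"
  have "continuous_on {a..d} g" by (rule continuous_on_subset[OF cont]) (use d in auto)
  then have "closed S"
    unfolding S_def by (intro continuous_on_closed_Collect_le continuous_on_const) auto
  then have "compact S"
    using compact_Int_closed[of "{a..d}" S] by (simp add: S_def Int_def conj_ac)
  moreover have "a \<in> S" using \<open>g a \<le> 0\<close> d by (simp add: S_def)
  ultimately obtain q where q: "q \<in> S" "\<And>x. x \<in> S \<Longrightarrow> x \<le> q"
    using compact_attains_sup[of S] by blast
  have after: "0 < g x" if "q < x" "x < b" for x
  proof (rule ccontr)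
    assume "\<not> 0 < g x"
    then have "x \<le> d" using c(2)[of x] that d by (meson less_trans not_le)
    then have "x \<in> S" using \<open>\<not> 0 < g x\<close> that q(1) by (simp add: S_def)
    then show False using q(2) that by force
  qed
  have "g q = 0"
  proof (rule ccontr)
    assume "g q \<noteq> 0"
    have "continuous_on {q..d} g"
      by (rule continuous_on_subset[OF cont]) (use q(1) d in \<open>auto simp: S_def\<close>)
    then obtain x where "q \<le> x" "x \<le> d" "g x = 0"
      using IVT'[of g q 0 d] q(1) c(2)[of d] d by (auto simp: S_def)
    then show False using after[of x] d \<open>g q \<noteq> 0\<close> by (cases "q = x") auto
  qed
  then show ?thesis using q(1) d after by (auto simp: S_def)
qed

lemma holomorphic_on_suminf_monomials:
  fixes a :: "nat \<Rightarrow> complex" and e :: "nat \<Rightarrow> nat"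
  assumes summable: "\<And>x. 0 \<le> x \<Longrightarrow> x < R \<Longrightarrow> summable (\<lambda>j. norm (a j) * x ^ e j)"
  shows "(\<lambda>z. \<Sum>j. a j * z ^ e j) holomorphic_on ball 0 R"
proof (rule holomorphic_uniform_sequence)
  show "(\<lambda>z. \<Sum>j<n. a j * z ^ e j) holomorphic_on ball 0 R" for n
    by (intro holomorphic_intros)
  show "\<exists>d>0. cball z d \<subseteq> ball 0 R \<and>
      uniform_limit (cball z d) (\<lambda>n z. \<Sum>j<n. a j * z ^ e j) (\<lambda>z. \<Sum>j. a j * z ^ e j) sequentially"
    if "z \<in> ball 0 R" for z
  proof -
    obtain x where x: "norm z < x" "x < R" using dense \<open>z \<in> ball 0 R\<close> by auto
    have norm_le: "norm u \<le> x" if "u \<in> cball z (x - norm z)" for u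
      using that norm_triangle_ineq2[of u z] by (simp add: dist_norm norm_minus_commute)
    have "uniform_limit (cball z (x - norm z)) (\<lambda>n z. \<Sum>j<n. a j * z ^ e j)
        (\<lambda>z. \<Sum>j. a j * z ^ e j) sequentially"
    proof (rule Weierstrass_m_test)
      show "norm (a j * u ^ e j) \<le> norm (a j) * x ^ e j" if "u \<in> cball z (x - norm z)" for j u
        using norm_le[OF that] by (simp add: norm_mult norm_power mult_left_mono power_mono)
      show "summable (\<lambda>j. norm (a j) * x ^ e j)"
        using x norm_ge_zero[of z] by (intro summable) linarith+
    qed
    moreover have "cball z (x - norm z) \<subseteq> ball 0 R" using norm_le x by force
    ultimately show ?thesis using x by (intro exI[of _ "x - norm z"]) simp
  qed
qed simp

section \<open>Greedy sums of monomials comparable to a growth function\<close>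

locale monomially_supported =
  fixes \<phi> :: "real \<Rightarrow> real" and K :: real
  assumes continuous: "continuous_on {0..<1} \<phi>"
    and monotone: "mono_on {0..<1} \<phi>"
    and positive_0: "0 < \<phi> 0"
    and unbounded: "filterlim \<phi> at_top (at_left 1)"
    and one_le_K: "1 \<le> K"
    and supporting_monomial:
      "r \<in> {1/2..<1} \<Longrightarrow> \<exists>m. \<forall>x\<in>{1/2..<1}. \<phi> r * (x / r) ^ m \<le> K * \<phi> x"
begin

lemma \<phi>_mono: "0 \<le> x \<Longrightarrow> x \<le> y \<Longrightarrow> y < 1 \<Longrightarrow> \<phi> x \<le> \<phi> y"
  using monotone by (auto simp: mono_on_def)

lemma \<phi>_pos: "0 \<le> x \<Longrightarrow> x < 1 \<Longrightarrow> 0 < \<phi> x"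
  using \<phi>_mono[of 0 x] positive_0 by simp

lemma \<phi>_le_K_mult: "0 \<le> x \<Longrightarrow> x < 1 \<Longrightarrow> \<phi> x \<le> K * \<phi> x"
  using mult_right_mono[OF one_le_K, of "\<phi> x"] \<phi>_pos[of x] by simp

text \<open>
  The slack \<open>4 * K\<close> makes the critical monomial at \<open>p\<close> overtake \<open>\<phi>\<close> by a factor \<open>2 * K\<close>.
  Without it consecutive exponents could be so close that the monomials do not separate.
\<close>
definition exponent :: "real \<Rightarrow> nat" where
  "exponent p = critical_exponent (\<lambda>x. 4 * K * \<phi> x) (\<phi> p) p"

definition monomial :: "real \<Rightarrow> real \<Rightarrow> real" where
  "monomial p x = \<phi> p * (x / p) ^ exponent p"

definition last_contact :: "real \<Rightarrow> real" where
  "last_contact p =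
     (SOME q. q \<in> {p..<1} \<and> monomial p q = \<phi> q \<and> (\<forall>x\<in>{q<..<1}. monomial p x < \<phi> x))"

lemma \<phi>_le_slack:
  assumes "0 \<le> p" "p \<le> x" "x < 1"
  shows "\<phi> p \<le> 4 * K * \<phi> x"
proof -
  have "\<phi> p \<le> \<phi> x" using assms by (rule \<phi>_mono)
  also have "\<dots> \<le> 4 * K * \<phi> x" using \<phi>_le_K_mult[of x] \<phi>_pos[of x] assms by simp
  finally show ?thesis .
qed

lemma le_exponent:
  assumes p: "p \<in> {1/2..<1}" and "\<And>x. x \<in> {p<..<1} \<Longrightarrow> \<phi> p * (x / p) ^ n \<le> 4 * K * \<phi> x"
  shows "n \<le> exponent p"
  unfolding exponent_def
  by (rule le_critical_exponent) (use assms \<phi>_pos \<phi>_le_slack in auto)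

lemma monomial_self: "p \<in> {1/2..<1} \<Longrightarrow> monomial p p = \<phi> p"
  by (auto simp: monomial_def)

lemma monomial_nonneg: "p \<in> {1/2..<1} \<Longrightarrow> 0 \<le> x \<Longrightarrow> 0 \<le> monomial p x"
  using \<phi>_pos[of p] by (auto simp: monomial_def)

lemma monomial_pos: "p \<in> {1/2..<1} \<Longrightarrow> 0 < x \<Longrightarrow> 0 < monomial p x"
  using \<phi>_pos[of p] by (auto simp: monomial_def)

lemma monomial_mono: "p \<in> {1/2..<1} \<Longrightarrow> 0 \<le> x \<Longrightarrow> x \<le> y \<Longrightarrow> monomial p x \<le> monomial p y"
  unfolding monomial_def using \<phi>_pos[of p]
  by (intro mult_left_mono power_mono divide_right_mono) auto

lemma monomial_le:
  assumes p: "p \<in> {1/2..<1}" and x: "p \<le> x" "x < 1"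
  shows "monomial p x \<le> 4 * K * \<phi> x"
proof (cases "x = p")
  case True
  then show ?thesis using \<phi>_le_slack[of p p] monomial_self[OF p] p by simp
next
  case False
  then show ?thesis
    unfolding monomial_def exponent_def
    using mult_power_critical_exponent_le[of "\<phi> p" p "\<lambda>x. 4 * K * \<phi> x" x]
      p x \<phi>_pos[of p] \<phi>_le_slack
    by simp
qed

lemma monomial_overtakes:
  assumes p: "p \<in> {1/2..<1}"
  shows "\<exists>t\<in>{p<..<1}. 2 * K * \<phi> t < monomial p t"
proof -
  obtain t where t: "t \<in> {p<..<1}" "4 * K * \<phi> t < \<phi> p * (t / p) ^ Suc (exponent p)"
    unfolding exponent_def
    using less_mult_power_Suc_critical_exponent[of "\<phi> p" p "\<lambda>x. 4 * K * \<phi> x"]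
      p \<phi>_pos[of p] \<phi>_le_slack
    by auto
  note t(2)
  also have "\<phi> p * (t / p) ^ Suc (exponent p) = monomial p t * (t / p)"
    by (simp add: monomial_def)
  also have "\<dots> \<le> monomial p t * 2"
    using t(1) p by (intro mult_left_mono monomial_nonneg) (auto simp: field_simps)
  finally show ?thesis using t(1) by (intro bexI[of _ t]) auto
qed

lemma last_contact:
  assumes p: "p \<in> {1/2..<1}"
  shows last_contact_bounds: "last_contact p \<in> {p..<1}"
    and monomial_last_contact: "monomial p (last_contact p) = \<phi> (last_contact p)"
    and monomial_less_after_last_contact:
      "\<And>x. last_contact p < x \<Longrightarrow> x < 1 \<Longrightarrow> monomial p x < \<phi> x"
proof -
  have cont: "continuous_on {p..<1} (\<lambda>x. \<phi> x - monomial p x)"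
    unfolding monomial_def using p
    by (intro continuous_intros continuous_on_subset[OF continuous]) auto
  have "eventually (\<lambda>x. monomial p 1 < \<phi> x) (at_left 1)"
    using unbounded by (simp add: filterlim_at_top_dense)
  moreover have "eventually (\<lambda>x::real. x \<in> {p<..<1}) (at_left 1)"
    using p by (intro eventually_at_left_real) simp
  ultimately have "eventually (\<lambda>x. 0 < \<phi> x - monomial p x) (at_left 1)"
  proof eventually_elim
    case (elim x)
    have "monomial p x \<le> monomial p 1"
      using elim p by (intro monomial_mono) simp_all
    then show ?case using elim by simp
  qed
  then obtain q where "q \<in> {p..<1}" "\<phi> q - monomial p q = 0"
      "\<forall>x\<in>{q<..<1}. 0 < \<phi> x - monomial p x"
    using last_zero_before_positive[OF cont] monomial_self[OF p] p by auto
  then have "\<exists>q. q \<in> {p..<1} \<and> monomial p q = \<phi> q \<and> (\<forall>x\<in>{q<..<1}. monomial p x < \<phi> x)"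
    by (intro exI[of _ q]) simp
  note contact = someI_ex[OF this, folded last_contact_def]
  show "last_contact p \<in> {p..<1}" using contact by blast
  show "monomial p (last_contact p) = \<phi> (last_contact p)" using contact by blast
  show "monomial p x < \<phi> x" if "last_contact p < x" "x < 1" for x using contact that by simp
qed

lemma last_contact_in:
  assumes "p \<in> {1/2..<1}"
  shows "last_contact p \<in> {1/2..<1}"
  using last_contact_bounds[OF assms] assms by auto

lemma monomial_overtakes_before_last_contact:
  assumes p: "p \<in> {1/2..<1}"
  shows "\<exists>t\<in>{p..last_contact p}. 2 * K * \<phi> t < monomial p t"
proof -
  obtain t where t: "t \<in> {p<..<1}" "2 * K * \<phi> t < monomial p t"
    using monomial_overtakes[OF p] by blast
  have "0 < \<phi> t" "\<phi> t \<le> K * \<phi> t" using t(1) p by (auto intro!: \<phi>_pos \<phi>_le_K_mult)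
  then have "\<phi> t < monomial p t" using t(2) by linarith
  then have "t \<le> last_contact p"
    using monomial_less_after_last_contact[OF p, of t] t by force
  then show ?thesis using t by auto
qed

lemma exponent_le_exponent_last_contact:
  assumes p: "p \<in> {1/2..<1}"
  shows "exponent p \<le> exponent (last_contact p)"
proof (rule le_exponent[OF last_contact_in[OF p]])
  let ?q = "last_contact p"
  have "\<phi> ?q * (x / ?q) ^ exponent p = monomial p x" for x
    using monomial_last_contact[OF p, symmetric] last_contact_in[OF p] p
    by (simp add: monomial_def power_divide)
  then show "\<phi> ?q * (x / ?q) ^ exponent p \<le> 4 * K * \<phi> x" if "x \<in> {?q<..<1}" for x
    using monomial_le[OF p, of x] last_contact_bounds[OF p] that by simp
qed

lemma mult_monomial_last_contact_le_below:
  assumes p: "p \<in> {1/2..<1}" and at_y: "c * monomial (last_contact p) y \<le> monomial p y"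
    and c: "0 \<le> c" and x: "0 \<le> x" "x \<le> y" and y: "0 < y"
  shows "c * monomial (last_contact p) x \<le> monomial p x"
proof -
  let ?q = "last_contact p"
  have q: "0 \<le> ?q" "0 \<le> c * \<phi> ?q"
    using c last_contact_in[OF p] \<phi>_pos[of ?q] by simp_all
  have "c * \<phi> ?q * (y / ?q) ^ exponent ?q \<le> \<phi> p * (y / p) ^ exponent p"
    using at_y by (simp add: monomial_def mult.assoc)
  from mult_power_le_below[OF this exponent_le_exponent_last_contact[OF p] q(2,1) x y]
  show ?thesis by (simp add: monomial_def mult.assoc)
qed

lemma mult_monomial_le_last_contact_above:
  assumes p: "p \<in> {1/2..<1}" and at_y: "c * monomial p y \<le> monomial (last_contact p) y"
    and y: "0 < y" "y \<le> x"
  shows "c * monomial p x \<le> monomial (last_contact p) x"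
proof -
  let ?q = "last_contact p"
  have q: "0 \<le> ?q" "0 \<le> \<phi> ?q"
    using last_contact_in[OF p] \<phi>_pos[of ?q] by simp_all
  have "c * \<phi> p * (y / p) ^ exponent p \<le> \<phi> ?q * (y / ?q) ^ exponent ?q"
    using at_y by (simp add: monomial_def mult.assoc)
  from mult_power_le_above[OF this exponent_le_exponent_last_contact[OF p] q(2,1) y]
  show ?thesis by (simp add: monomial_def mult.assoc)
qed

lemma monomial_last_contact_le_below:
  assumes p: "p \<in> {1/2..<1}" and x: "0 \<le> x" "x \<le> last_contact p"
  shows "monomial (last_contact p) x \<le> monomial p x"
  using mult_monomial_last_contact_le_below[OF p, of 1 "last_contact p" x]
    monomial_last_contact[OF p] monomial_self last_contact_in[OF p] x by simp

lemma monomial_le_last_contact_above: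
  assumes p: "p \<in> {1/2..<1}" and x: "last_contact p \<le> x"
  shows "monomial p x \<le> monomial (last_contact p) x"
  using mult_monomial_le_last_contact_above[OF p, of 1 "last_contact p" x]
    monomial_last_contact[OF p] monomial_self last_contact_in[OF p] x by simp

lemma twice_monomial_last_contact_le_below:
  assumes p: "p \<in> {1/2..<1}" and x: "0 \<le> x" "x \<le> p"
  shows "2 * monomial (last_contact p) x \<le> monomial p x"
proof -
  let ?q = "last_contact p"
  note q = last_contact_in[OF p]
  obtain m where m: "\<And>x. x \<in> {1/2..<1} \<Longrightarrow> \<phi> ?q * (x / ?q) ^ m \<le> K * \<phi> x"
    using supporting_monomial[OF q] by blast
  have "m \<le> exponent ?q"
  proof (rule le_exponent[OF q])
    fix x assume x: "x \<in> {?q<..<1}"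
    have "\<phi> ?q * (x / ?q) ^ m \<le> K * \<phi> x" using x q by (intro m) auto
    also have "\<dots> \<le> 4 * K * \<phi> x" using x q \<phi>_pos[of x] one_le_K by simp
    finally show "\<phi> ?q * (x / ?q) ^ m \<le> 4 * K * \<phi> x" .
  qed
  obtain t where t: "t \<in> {p..?q}" "2 * K * \<phi> t < monomial p t"
    using monomial_overtakes_before_last_contact[OF p] by blast
  have "monomial ?q t \<le> \<phi> ?q * (t / ?q) ^ m"
    unfolding monomial_def using t(1) p q \<phi>_pos[of ?q] \<open>m \<le> exponent ?q\<close>
    by (intro mult_left_mono power_decreasing) auto
  also have "\<dots> \<le> K * \<phi> t" using t(1) p q by (intro m) auto
  finally have "2 * monomial ?q t \<le> monomial p t" using t(2) by simp
  then show ?thesis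
    by (rule mult_monomial_last_contact_le_below[OF p]) (use t(1) p x in simp_all)
qed

lemma twice_monomial_le_last_contact_above:
  assumes p: "p \<in> {1/2..<1}" and x: "last_contact (last_contact p) \<le> x"
  shows "2 * monomial p x \<le> monomial (last_contact p) x"
proof -
  let ?q = "last_contact p"
  note q = last_contact_in[OF p]
  obtain t where t: "t \<in> {?q..last_contact ?q}" "2 * K * \<phi> t < monomial ?q t"
    using monomial_overtakes_before_last_contact[OF q] by blast
  have t01: "0 < t" "t < 1" using t(1) q last_contact_in[OF q] by simp_all
  have "monomial p t \<le> \<phi> t"
  proof (cases "t = ?q")
    case True
    then show ?thesis using monomial_last_contact[OF p] by simp
  next
    case False
    then show ?thesis using monomial_less_after_last_contact[OF p, of t] t(1) t01 by simp
  qed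
  also have "\<dots> \<le> K * \<phi> t" using t01 by (intro \<phi>_le_K_mult) simp_all
  finally have "2 * monomial p t \<le> monomial ?q t" using t(2) by simp
  then show ?thesis
    by (rule mult_monomial_le_last_contact_above[OF p]) (use t(1) t01 x in simp_all)
qed

lemma le_K_mult_monomial:
  assumes p: "p \<in> {1/2..<1}" and x: "p \<le> x" "x \<le> last_contact p"
  shows "\<phi> x \<le> K * monomial p x"
proof -
  let ?q = "last_contact p"
  note q = last_contact_in[OF p]
  have x_in: "x \<in> {1/2..<1}" using x p q by auto
  then obtain m where m: "\<And>y. y \<in> {1/2..<1} \<Longrightarrow> \<phi> x * (y / x) ^ m \<le> K * \<phi> y"
    using supporting_monomial by blast
  have "\<phi> x * (x / x) ^ m \<le> K * \<phi> p * (x / p) ^ exponent p"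
  proof (cases "m \<le> exponent p")
    case True
    have "\<phi> x * (p / x) ^ m \<le> K * \<phi> p * (p / p) ^ exponent p" using m[OF p] p by simp
    then show ?thesis
      by (rule mult_power_le_above[OF _ True]) (use x p one_le_K \<phi>_pos[of p] in auto)
  next
    case False
    then have "exponent p \<le> m" by simp
    have "\<phi> x * (?q / x) ^ m \<le> K * \<phi> p * (?q / p) ^ exponent p"
      using m[OF q] unfolding monomial_last_contact[OF p, symmetric]
      by (simp add: monomial_def mult.assoc)
    then show ?thesis
      by (rule mult_power_le_below[OF _ \<open>exponent p \<le> m\<close>]) (use x x_in \<phi>_pos[of x] in auto)
  qed
  then show ?thesis using x_in by (auto simp: monomial_def)
qed

definition node :: "nat \<Rightarrow> real" where
  "node k = (last_contact ^^ k) (1/2)"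

lemma node_0 [simp]: "node 0 = 1/2" and node_Suc: "node (Suc k) = last_contact (node k)"
  by (simp_all add: node_def)

lemma node_in: "node k \<in> {1/2..<1}"
  by (induction k) (simp, simp only: node_Suc last_contact_in)

lemma mono_node: "mono node"
  unfolding mono_iff_le_Suc using last_contact_bounds[OF node_in] by (auto simp: node_Suc)

lemma twice_monomial_node_le_Suc:
  assumes "node (Suc (Suc k)) \<le> x"
  shows "2 * monomial (node k) x \<le> monomial (node (Suc k)) x"
  using twice_monomial_le_last_contact_above[OF node_in] assms by (simp add: node_Suc)

lemma twice_monomial_node_Suc_le:
  assumes "0 \<le> x" "x \<le> node k"
  shows "2 * monomial (node (Suc k)) x \<le> monomial (node k) x"
  using twice_monomial_last_contact_le_below[OF node_in] assms by (simp add: node_Suc)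

lemma node_cofinal:
  assumes "x < 1"
  shows "\<exists>k. x < node k"
proof (rule ccontr)
  assume "\<not> ?thesis"
  then have node_le: "node k \<le> x" for k by (meson not_le)
  have "1/2 \<le> x" using node_le[of 0] by simp
  have "2 ^ k * monomial (node 0) x \<le> monomial (node k) x" for k
  proof (induction k)
    case (Suc k)
    then show ?case using twice_monomial_node_le_Suc[of k x] node_le by simp
  qed simp
  moreover have "monomial (node k) x \<le> 4 * K * \<phi> x" for k
    by (rule monomial_le[OF node_in node_le assms])
  ultimately have "monomial (node 0) x * 2 ^ k \<le> 4 * K * \<phi> x" for k
    by (metis mult.commute order_trans)
  moreover have "0 < monomial (node 0) x"
    using \<open>1/2 \<le> x\<close> by (intro monomial_pos node_in) simp
  then obtain k where "4 * K * \<phi> x < monomial (node 0) x * 2 ^ k"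
    using ex_less_mult_power[of "monomial (node 0) x" 2 "4 * K * \<phi> x"] by auto
  ultimately show False by (meson not_le)
qed

lemma between_nodes:
  assumes "1/2 \<le> x" "x < 1"
  shows "\<exists>k. node k \<le> x \<and> x \<le> node (Suc k)"
proof -
  obtain n where "x < node n" using node_cofinal[OF assms(2)] by blast
  then obtain k where "\<not> x < node k" "x < node (Suc k)"
    using ex_least_nat_less[of "\<lambda>n. x < node n" n] assms(1) by auto
  then show ?thesis by (meson less_imp_le not_less)
qed

lemma sum_monomial_node_le:
  assumes x: "0 \<le> x" "x < 1"
  shows "(\<Sum>j<n. monomial (node j) x) \<le> 20 * K * \<phi> (max x (1/2))"
proof -
  define y where "y = max x (1/2)"
  have y: "1/2 \<le> y" "y < 1" "x \<le> y" using x by (auto simp: y_def)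
  obtain k where k: "node k \<le> y" "y \<le> node (Suc k)" using between_nodes[OF y(1,2)] by blast
  have "(\<Sum>j<n. monomial (node j) x) \<le> (\<Sum>j<n. monomial (node j) y)"
    using x y by (intro sum_mono monomial_mono node_in)
  also have "\<dots> \<le> 5 * monomial (node k) y"
  proof (rule sum_le_of_geometric_peak)
    show "0 \<le> monomial (node j) y" for j using y by (intro monomial_nonneg node_in) simp
    show "2 * monomial (node j) y \<le> monomial (node (Suc j)) y" if "Suc j < k" for j
      using that k(1) monoD[OF mono_node, of "Suc (Suc j)" k]
      by (intro twice_monomial_node_le_Suc) simp
    show "monomial (node j) y \<le> monomial (node k) y" if "Suc j = k" for j
      using monomial_le_last_contact_above[OF node_in, of j y] k(1) that[symmetric]
      by (simp add: node_Suc)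
    show "monomial (node (Suc k)) y \<le> monomial (node k) y"
      using monomial_last_contact_le_below[OF node_in, of y k] k(2) y by (simp add: node_Suc)
    show "2 * monomial (node (Suc j)) y \<le> monomial (node j) y" if "k < j" for j
      using that k(2) y monoD[OF mono_node, of "Suc k" j]
      by (intro twice_monomial_node_Suc_le) simp_all
  qed
  also have "\<dots> \<le> 20 * K * \<phi> y" using monomial_le[OF node_in k(1) y(2)] by simp
  finally show ?thesis by (simp add: y_def)
qed

lemma summable_monomial_node:
  assumes "0 \<le> x" "x < 1"
  shows "summable (\<lambda>j. monomial (node j) x)"
  by (rule summableI_nonneg_bounded[OF monomial_nonneg[OF node_in] sum_monomial_node_le])
    (use assms in simp_all)

lemma suminf_monomial_node_le:
  assumes "0 \<le> x" "x < 1"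
  shows "(\<Sum>j. monomial (node j) x) \<le> 20 * K * \<phi> (max x (1/2))"
  by (rule suminf_le_const[OF summable_monomial_node sum_monomial_node_le])
    (use assms in simp_all)

lemma le_K_mult_suminf_monomial_node:
  assumes x: "1/2 \<le> x" "x < 1"
  shows "\<phi> x \<le> K * (\<Sum>j. monomial (node j) x)"
proof -
  obtain k where k: "node k \<le> x" "x \<le> node (Suc k)" using between_nodes[OF x] by blast
  have "\<phi> x \<le> K * monomial (node k) x"
    using le_K_mult_monomial[OF node_in k(1)] k(2) by (simp add: node_Suc)
  also have "monomial (node k) x \<le> (\<Sum>j. monomial (node j) x)"
    using sum_le_suminf[OF summable_monomial_node, of x "{k}"] x monomial_nonneg[OF node_in]
    by simp
  finally show ?thesis using one_le_K by simp
qed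

definition coefficient :: "nat \<Rightarrow> real" where
  "coefficient j = \<phi> (node j) / node j ^ exponent (node j)"

definition monomial_series :: "complex \<Rightarrow> complex" where
  "monomial_series z = (\<Sum>j. complex_of_real (coefficient j) * z ^ exponent (node j))"

lemma coefficient_nonneg: "0 \<le> coefficient j"
  using node_in[of j] \<phi>_pos[of "node j"] by (simp add: coefficient_def)

lemma coefficient_mult_power: "coefficient j * x ^ exponent (node j) = monomial (node j) x"
  by (simp add: coefficient_def monomial_def power_divide)

lemma summable_coefficient_power:
  "0 \<le> x \<Longrightarrow> x < 1 \<Longrightarrow> summable (\<lambda>j. coefficient j * x ^ exponent (node j))"
  using summable_monomial_node by (simp add: coefficient_mult_power)

lemma monomial_series_holomorphic: "monomial_series holomorphic_on unit_disc"
  unfolding monomial_series_def using summable_coefficient_power coefficient_nonneg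
  by (intro holomorphic_on_suminf_monomials) simp

lemma monomial_series_of_real:
  assumes "0 \<le> x" "x < 1"
  shows "monomial_series (complex_of_real x) = complex_of_real (\<Sum>j. monomial (node j) x)"
  using suminf_of_real[OF summable_coefficient_power[OF assms], where 'a = complex]
  by (simp add: monomial_series_def flip: coefficient_mult_power)

lemma norm_monomial_series_le:
  assumes z: "norm z < 1"
  shows "norm (monomial_series z) \<le> 20 * K * \<phi> (max (norm z) (1/2))"
proof -
  have "norm (monomial_series z) \<le> (\<Sum>j. coefficient j * norm z ^ exponent (node j))"
    unfolding monomial_series_def
    using summable_norm[of "\<lambda>j. complex_of_real (coefficient j) * z ^ exponent (node j)"]
      summable_coefficient_power[OF norm_ge_zero z] coefficient_nonneg
    by (simp add: norm_mult norm_power)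
  also have "\<dots> \<le> 20 * K * \<phi> (max (norm z) (1/2))"
    unfolding coefficient_mult_power by (rule suminf_monomial_node_le[OF norm_ge_zero z])
  finally show ?thesis .
qed

lemma \<phi>_max_half_le:
  assumes x: "0 \<le> x" "x < 1"
  shows "\<phi> (max x (1/2)) \<le> \<phi> (1/2) / \<phi> 0 * \<phi> x"
proof (cases "x \<le> 1/2")
  case True
  have "\<phi> (1/2) * \<phi> 0 \<le> \<phi> (1/2) * \<phi> x"
    using x \<phi>_pos[of "1/2"] by (intro mult_left_mono \<phi>_mono) simp_all
  then show ?thesis using True positive_0 by (simp add: max_def field_simps)
next
  case False
  have "\<phi> x * \<phi> 0 \<le> \<phi> x * \<phi> (1/2)"
    using x \<phi>_pos[of x] by (intro mult_left_mono \<phi>_mono) simp_all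
  then show ?thesis using False positive_0 by (simp add: max_def field_simps)
qed

lemma holomorphic_comparable:
  obtains F C where "F holomorphic_on unit_disc"
    and "\<And>z. norm z < 1 \<Longrightarrow> norm (F z) \<le> C * \<phi> (norm z)"
    and "\<And>x. 0 \<le> x \<Longrightarrow> x < 1 \<Longrightarrow> \<phi> x \<le> Re (F (complex_of_real x))"
proof
  let ?F = "\<lambda>z. complex_of_real K * (complex_of_real (\<phi> (1/2)) + monomial_series z)"
  let ?C = "K * (1 + 20 * K) * (\<phi> (1/2) / \<phi> 0)"
  show "?F holomorphic_on unit_disc"
    by (intro holomorphic_intros monomial_series_holomorphic)
  show "norm (?F z) \<le> ?C * \<phi> (norm z)" if z: "norm z < 1" for z
  proof -
    let ?y = "max (norm z) (1/2)"
    have "norm (complex_of_real (\<phi> (1/2)) + monomial_series z) \<le> \<phi> (1/2) + 20 * K * \<phi> ?y"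
      using norm_monomial_series_le[OF z] \<phi>_pos[of "1/2"] by (intro norm_triangle_le) simp
    also have "\<dots> \<le> (1 + 20 * K) * \<phi> ?y"
      using \<phi>_mono[of "1/2" ?y] z by (simp add: distrib_right)
    also have "\<dots> \<le> (1 + 20 * K) * (\<phi> (1/2) / \<phi> 0 * \<phi> (norm z))"
      using \<phi>_max_half_le[OF norm_ge_zero z] one_le_K by (intro mult_left_mono) simp_all
    finally have "K * norm (complex_of_real (\<phi> (1/2)) + monomial_series z)
        \<le> K * ((1 + 20 * K) * (\<phi> (1/2) / \<phi> 0 * \<phi> (norm z)))"
      using one_le_K by (intro mult_left_mono) simp_all
    then show ?thesis using one_le_K by (simp add: norm_mult mult.assoc)
  qed
  show "\<phi> x \<le> Re (?F (complex_of_real x))" if x: "0 \<le> x" "x < 1" for x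
  proof -
    have "0 \<le> K * (\<Sum>j. monomial (node j) x)"
      using x one_le_K
      by (intro mult_nonneg_nonneg suminf_nonneg summable_monomial_node monomial_nonneg node_in)
        simp_all
    moreover have "0 \<le> K * \<phi> (1/2)" using \<phi>_pos[of "1/2"] one_le_K by simp
    moreover have "\<phi> x \<le> K * \<phi> (1/2) \<or> \<phi> x \<le> K * (\<Sum>j. monomial (node j) x)"
      using x le_K_mult_suminf_monomial_node[of x] \<phi>_mono[of x "1/2"] \<phi>_le_K_mult[of "1/2"]
      by (cases "x < 1/2") simp_all
    ultimately show ?thesis using x by (auto simp: monomial_series_of_real distrib_left)
  qed
qed

end

section \<open>Essential weights\<close>

lemma annulus_maximum_modulus:
  assumes "g holomorphic_on cball a R - ball a r" and "0 < r"
    and boundary: "\<And>z. z \<in> sphere a r \<union> sphere a R \<Longrightarrow> norm (g z) \<le> B"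
    and "w \<in> cball a R - ball a r"
  shows "norm (g w) \<le> B"
proof (rule maximum_modulus_frontier[where f = g and S = "cball a R - ball a r"])
  let ?A = "cball a R - ball a r"
  show "g holomorphic_on interior ?A"
    using assms(1) interior_subset by (rule holomorphic_on_subset)
  show "continuous_on (closure ?A) g"
    using assms(1) by (simp add: closed_Diff holomorphic_on_imp_continuous_on)
  show "bounded ?A" by (meson Diff_subset bounded_cball bounded_subset)
  have "frontier ?A \<subseteq> sphere a r \<union> sphere a R"
    using frontier_Int_subset[of "cball a R" "- ball a r"] \<open>0 < r\<close> by (auto simp: Diff_eq)
  then show "norm (g z) \<le> B" if "z \<in> frontier ?A" for z
    using that boundary by blast
qed fact

text \<open>
  The critical exponent \<open>m\<close> is the required one: by the dichotomy \<open>Suc m\<close> works to the left of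
  \<open>r\<close>, and passing from \<open>Suc m\<close> to \<open>m\<close> costs only a factor 2 on \<open>[1/2,r]\<close>.
\<close>
lemma ex_supporting_monomial:
  fixes \<phi> :: "real \<Rightarrow> real"
  assumes pos: "\<And>x. x \<in> {0<..<1} \<Longrightarrow> 0 < \<phi> x"
    and mono: "mono_on {0<..<1} \<phi>"
    and c: "0 < c" "c \<le> 1" and r: "r \<in> {1/2..<1}"
    and dichotomy: "\<And>x y n. x \<in> {0<..<r} \<Longrightarrow> y \<in> {r<..<1} \<Longrightarrow>
      c * \<phi> r * (x / r) ^ n \<le> \<phi> x \<or> c * \<phi> r * (y / r) ^ n \<le> \<phi> y"
  shows "\<exists>m. \<forall>x\<in>{1/2..<1}. \<phi> r * (x / r) ^ m \<le> 2 / c * \<phi> x"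
proof -
  let ?a = "c * \<phi> r"
  define m where "m = critical_exponent \<phi> ?a r"
  have "0 < \<phi> r" using r by (intro pos) auto
  have a_pos: "0 < ?a" using c \<open>0 < \<phi> r\<close> by simp
  have a_le: "?a \<le> \<phi> y" if "y \<in> {r..<1}" for y
  proof -
    have "?a \<le> 1 * \<phi> r" using c \<open>0 < \<phi> r\<close> by (intro mult_right_mono) simp_all
    also have "\<dots> \<le> \<phi> y" using mono_onD[OF mono, of r y] r that by simp
    finally show ?thesis .
  qed
  have right: "?a * (x / r) ^ m \<le> \<phi> x" if "x \<in> {r<..<1}" for x
    unfolding m_def by (rule mult_power_critical_exponent_le) (use a_pos a_le r that in auto)
  have "\<exists>y\<in>{r<..<1}. \<phi> y < ?a * (y / r) ^ Suc m"
    unfolding m_def by (rule less_mult_power_Suc_critical_exponent) (use a_pos a_le r in auto)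
  then have left: "?a * (x / r) ^ Suc m \<le> \<phi> x" if "x \<in> {0<..<r}" for x
    using dichotomy[OF that] by (meson not_less)
  have "?a * (x / r) ^ m \<le> 2 * \<phi> x" if x: "x \<in> {1/2..<1}" for x
  proof (cases x r rule: linorder_cases)
    case less
    have "0 \<le> ?a * (x / r) ^ m" using c \<open>0 < \<phi> r\<close> x r by simp
    then have "?a * (x / r) ^ m * 1 \<le> ?a * (x / r) ^ m * (2 * (x / r))"
      by (rule mult_left_mono[rotated]) (use x r in \<open>simp add: le_divide_eq\<close>)
    also have "\<dots> = 2 * (?a * (x / r) ^ Suc m)" by simp
    also have "\<dots> \<le> 2 * \<phi> x" using left x less by (intro mult_left_mono) simp_all
    finally show ?thesis by simp
  next
    case equal
    then show ?thesis using a_le[of r] r \<open>0 < \<phi> r\<close> by simp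
  next
    case greater
    then show ?thesis using right[of x] x pos[of x] by simp
  qed
  then show ?thesis using c by (intro exI[of _ m]) (simp add: field_simps)
qed

definition growth :: "(complex \<Rightarrow> real) \<Rightarrow> real \<Rightarrow> real" where
  "growth v r = 1 / v (complex_of_real r)"

definition associated_growth :: "(complex \<Rightarrow> real) \<Rightarrow> complex \<Rightarrow> real" where
  "associated_growth v z = Sup {norm (f z) | f. in_Hv v f \<and> Hv_norm v f \<le> 1}"

lemma
  assumes "is_weight v"
  shows weight_pos: "\<And>z. norm z < 1 \<Longrightarrow> 0 < v z"
    and weight_radial: "\<And>z. norm z < 1 \<Longrightarrow> v (complex_of_real (norm z)) = v z"
    and weight_antimono: "\<And>z u. norm z \<le> norm u \<Longrightarrow> norm u < 1 \<Longrightarrow> v u \<le> v z"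
    and weight_continuous_on: "continuous_on unit_disc v"
    and weight_tendsto_0: "((\<lambda>r. v (complex_of_real r)) \<longlongrightarrow> 0) (at_left 1)"
proof -
  note weight = assms[unfolded is_weight_def Ball_def mem_ball_0]
  show "0 < v z" if "norm z < 1" for z using weight that by blast
  show "v (complex_of_real (norm z)) = v z" if "norm z < 1" for z
    using weight that by metis
  show "v u \<le> v z" if "norm z \<le> norm u" "norm u < 1" for z u
    using weight that le_less_trans by blast
qed (use assms in \<open>unfold is_weight_def, blast+\<close>)

lemma Hv_norm_upper:
  assumes "in_Hv v f" "norm z < 1"
  shows "v z * norm (f z) \<le> Hv_norm v f"
  unfolding Hv_norm_def using assms by (intro cSUP_upper) (simp_all add: in_Hv_def)

context
  fixes v :: "complex \<Rightarrow> real"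
  assumes v: "is_weight v"
begin

lemma growth_pos: "0 \<le> r \<Longrightarrow> r < 1 \<Longrightarrow> 0 < growth v r"
  using weight_pos[OF v] by (simp add: growth_def)

lemma growth_norm: "norm z < 1 \<Longrightarrow> growth v (norm z) = 1 / v z"
  by (simp add: growth_def weight_radial[OF v])

lemma growth_mono_on: "mono_on {0..<1} (growth v)"
  unfolding growth_def
  by (intro mono_onI divide_left_mono weight_antimono[OF v] mult_pos_pos weight_pos[OF v]) auto

lemma growth_continuous_on: "continuous_on {0..<1} (growth v)"
proof -
  have "continuous_on {0..<1} (\<lambda>r. v (complex_of_real r))"
    by (rule continuous_on_compose2[OF weight_continuous_on[OF v]])
      (auto intro!: continuous_intros)
  moreover have "v (complex_of_real r) \<noteq> 0" if "r \<in> {0..<1}" for r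
    using weight_pos[OF v, of "complex_of_real r"] that by auto
  ultimately show ?thesis
    unfolding growth_def by (intro continuous_intros) blast+
qed

lemma growth_at_top: "filterlim (growth v) at_top (at_left 1)"
proof -
  have "eventually (\<lambda>r::real. r \<in> {0<..<1}) (at_left 1)"
    by (rule eventually_at_left_real) simp
  then have "eventually (\<lambda>r. 0 < v (complex_of_real r)) (at_left 1)"
    by eventually_elim (simp add: weight_pos[OF v])
  from filterlim_inverse_at_top[OF weight_tendsto_0[OF v] this]
  show ?thesis by (simp add: growth_def[abs_def] inverse_eq_divide)
qed

lemma norm_le_Hv_norm_mult_growth:
  assumes "in_Hv v f" "norm z < 1"
  shows "norm (f z) \<le> Hv_norm v f * growth v (norm z)"
  using Hv_norm_upper[OF assms] weight_pos[OF v assms(2)]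
  by (simp add: growth_norm[OF assms(2)] field_simps)

lemma Hv_norm_nonneg:
  assumes "in_Hv v f"
  shows "0 \<le> Hv_norm v f"
  using order_trans[OF _ Hv_norm_upper[OF assms, of 0]] weight_pos[OF v, of 0] by simp

lemma in_Hv_if_norm_le_growth:
  assumes "f holomorphic_on unit_disc"
    and bound: "\<And>z. norm z < 1 \<Longrightarrow> norm (f z) \<le> C * growth v (norm z)"
  shows "in_Hv v f" "Hv_norm v f \<le> C"
proof -
  have le: "v z * norm (f z) \<le> C" if "z \<in> unit_disc" for z
    using bound[of z] weight_pos[OF v, of z] that by (simp add: growth_norm field_simps)
  then show "in_Hv v f" unfolding in_Hv_def using assms(1) by (intro conjI bdd_aboveI2)
  show "Hv_norm v f \<le> C" unfolding Hv_norm_def using le by (intro cSUP_least) simp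
qed

lemma associated_growth_le:
  assumes "\<And>f. in_Hv v f \<Longrightarrow> Hv_norm v f \<le> 1 \<Longrightarrow> norm (f z) \<le> B"
  shows "associated_growth v z \<le> B"
  unfolding associated_growth_def
proof (rule cSup_least)
  have "in_Hv v (\<lambda>_. 0)" "Hv_norm v (\<lambda>_. 0) \<le> 1"
    using in_Hv_if_norm_le_growth[of "\<lambda>_. 0" 1] growth_pos by (simp_all add: less_imp_le)
  then show "{norm (f z) | f. in_Hv v f \<and> Hv_norm v f \<le> 1} \<noteq> {}" by blast
qed (use assms in blast)

lemma essential_weightE:
  assumes "essential_weight v"
  obtains c where "0 < c" "c \<le> 1"
    and "\<And>r. 0 \<le> r \<Longrightarrow> r < 1 \<Longrightarrow> c * growth v r \<le> associated_growth v (complex_of_real r)"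
proof -
  obtain c where "0 < c"
    and lower: "\<And>z. norm z < 1 \<Longrightarrow> c / v z \<le> associated_growth v z"
    and upper: "\<And>z. norm z < 1 \<Longrightarrow> associated_growth v z \<le> 1 / v z"
    using assms unfolding essential_weight_def associated_growth_def by auto
  show ?thesis
  proof
    show "0 < c" by fact
    have "c / v 0 \<le> 1 / v 0" using lower[of 0] upper[of 0] by simp
    then show "c \<le> 1" using weight_pos[OF v, of 0] by (simp add: divide_le_cancel)
    show "c * growth v r \<le> associated_growth v (complex_of_real r)" if "0 \<le> r" "r < 1" for r
      using lower[of "complex_of_real r"] that by (simp add: growth_def)
  qed
qed

lemma norm_le_max_growth_annulus:
  assumes f: "in_Hv v f" "Hv_norm v f \<le> 1"
    and w: "x \<le> norm w" "norm w \<le> y" and xy: "0 < x" "y < 1"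
  shows "norm (f w) \<le> max (growth v x / x ^ n) (growth v y / y ^ n) * norm w ^ n"
proof -
  let ?B = "max (growth v x / x ^ n) (growth v y / y ^ n)"
  let ?A = "cball 0 y - ball 0 x :: complex set"
  have "norm (f w / w ^ n) \<le> ?B"
  proof (rule annulus_maximum_modulus[where g = "\<lambda>z. f z / z ^ n"])
    have "f holomorphic_on ?A"
      by (rule holomorphic_on_subset[of f unit_disc]) (use f(1) xy in \<open>auto simp: in_Hv_def\<close>)
    then show "(\<lambda>z. f z / z ^ n) holomorphic_on ?A"
      using xy by (intro holomorphic_intros) auto
    show "norm (f z / z ^ n) \<le> ?B" if "z \<in> sphere 0 x \<union> sphere 0 y" for z
    proof -
      have z: "norm z = x \<or> norm z = y" "norm z < 1" using that w xy by auto
      have "norm (f z) \<le> Hv_norm v f * growth v (norm z)"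
        by (rule norm_le_Hv_norm_mult_growth[OF f(1) z(2)])
      also have "\<dots> \<le> 1 * growth v (norm z)"
        using f(2) growth_pos[of "norm z"] z(2) by (intro mult_right_mono) simp_all
      finally have "norm (f z / z ^ n) \<le> growth v (norm z) / norm z ^ n"
        by (simp add: norm_divide norm_power divide_right_mono)
      then show ?thesis using z(1) by auto
    qed
  qed (use w xy in auto)
  moreover have "0 < norm w ^ n" using w(1) xy(1) by (intro zero_less_power) linarith
  ultimately show ?thesis by (simp only: norm_divide norm_power pos_divide_le_eq)
qed

lemma growth_annulus_dichotomy:
  assumes c: "c * growth v r \<le> associated_growth v (complex_of_real r)"
    and x: "x \<in> {0<..<r}" and y: "y \<in> {r<..<1}"
  shows "c * growth v r * (x / r) ^ n \<le> growth v x \<or> c * growth v r * (y / r) ^ n \<le> growth v y"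
proof -
  let ?B = "max (growth v x / x ^ n) (growth v y / y ^ n)"
  have "associated_growth v (complex_of_real r) \<le> ?B * norm (complex_of_real r) ^ n"
    using x y by (intro associated_growth_le norm_le_max_growth_annulus) simp_all
  with c have le: "c * growth v r \<le> ?B * r ^ n" using x by simp
  have "c * growth v r * (s / r) ^ n \<le> growth v s" if "?B = growth v s / s ^ n" "0 < s" for s
    using mult_right_mono[OF le, of "(s / r) ^ n"] that x by (simp add: power_divide)
  moreover have "?B = growth v x / x ^ n \<or> ?B = growth v y / y ^ n" by (simp add: max_def)
  ultimately show ?thesis using x y by auto
qed

lemma essential_weight_monomially_supported:
  assumes "essential_weight v"
  obtains K where "monomially_supported (growth v) K"
proof -
  obtain c where c: "0 < c" "c \<le> 1"
    and growth_le: "\<And>r. 0 \<le> r \<Longrightarrow> r < 1 \<Longrightarrow>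
      c * growth v r \<le> associated_growth v (complex_of_real r)"
    using essential_weightE[OF assms] by blast
  have "monomially_supported (growth v) (2 / c)"
  proof
    fix r :: real assume r: "r \<in> {1/2..<1}"
    show "\<exists>m. \<forall>x\<in>{1/2..<1}. growth v r * (x / r) ^ m \<le> 2 / c * growth v x"
    proof (rule ex_supporting_monomial[OF _ _ c r])
      show "mono_on {0<..<1} (growth v)"
        by (rule mono_on_subset[OF growth_mono_on]) auto
      show "c * growth v r * (x / r) ^ n \<le> growth v x \<or> c * growth v r * (y / r) ^ n \<le> growth v y"
        if "x \<in> {0<..<r}" "y \<in> {r<..<1}" for x y n
        using r that by (intro growth_annulus_dichotomy growth_le) auto
    qed (simp add: growth_pos)
  qed (use c growth_pos growth_mono_on growth_continuous_on growth_at_top in simp_all)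
  then show ?thesis by (rule that)
qed

lemma essential_weight_test_function:
  assumes "essential_weight v"
  obtains F where "in_Hv v F"
    and "\<And>t. 0 \<le> t \<Longrightarrow> t < 1 \<Longrightarrow> growth v t \<le> Re (F (complex_of_real t))"
proof -
  obtain K where "monomially_supported (growth v) K"
    using essential_weight_monomially_supported[OF assms] .
  then interpret monomially_supported "growth v" K .
  show ?thesis
    using holomorphic_comparable in_Hv_if_norm_le_growth(1) that by metis
qed

end

section \<open>The integral operator\<close>

lemma sums_integral_geometric:
  fixes g q :: "'a \<Rightarrow> complex"
  assumes g: "integrable M g" and q: "q \<in> borel_measurable M"
    and norm_q: "\<And>t. t \<in> space M \<Longrightarrow> norm (q t) \<le> \<rho>" and \<rho>: "0 \<le> \<rho>" "\<rho> < 1"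
  shows "(\<lambda>n. \<integral>t. g t * q t ^ n \<partial>M) sums (\<integral>t. g t / (1 - q t) \<partial>M)"
proof -
  have [measurable]: "g \<in> borel_measurable M" "q \<in> borel_measurable M"
    using g q by auto
  have norm_le: "norm (g t * q t ^ n) \<le> norm (g t) * \<rho> ^ n" if "t \<in> space M" for n t
    using power_mono[OF norm_q[OF that], of n]
    by (simp add: norm_mult norm_power mult_left_mono)
  have int: "integrable M (\<lambda>t. g t * q t ^ n)" for n
  proof (rule Bochner_Integration.integrable_bound)
    show "integrable M (\<lambda>t. norm (g t) * \<rho> ^ n)" using g by simp
  qed (use norm_le \<rho> in auto)
  have summable: "summable (\<lambda>n. c * \<rho> ^ n)" for c :: real
    using \<rho> by (intro summable_mult summable_geometric) simp
  have "(\<lambda>n. \<integral>t. g t * q t ^ n \<partial>M) sums (\<integral>t. (\<Sum>n. g t * q t ^ n) \<partial>M)"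
  proof (rule sums_integral[OF int])
    show "AE t in M. summable (\<lambda>n. norm (g t * q t ^ n))"
      by (intro AE_I2 summable_comparison_test'[OF summable]) (use norm_le in auto)
    show "summable (\<lambda>n. \<integral>t. norm (g t * q t ^ n) \<partial>M)"
    proof (rule summable_comparison_test'[OF summable])
      fix n
      have "(\<integral>t. norm (g t * q t ^ n) \<partial>M) \<le> (\<integral>t. norm (g t) * \<rho> ^ n \<partial>M)"
        using g int norm_le by (intro integral_mono integrable_norm integrable_mult_left) auto
      then show "norm (\<integral>t. norm (g t * q t ^ n) \<partial>M) \<le> (\<integral>t. norm (g t) \<partial>M) * \<rho> ^ n" by simp
    qed
  qed
  moreover have "(\<Sum>n. g t * q t ^ n) = g t / (1 - q t)" if "t \<in> space M" for t
    using norm_q[OF that] \<rho> by (simp add: suminf_mult suminf_geometric summable_geometric)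
  ultimately show ?thesis by (simp cong: Bochner_Integration.integral_cong)
qed

abbreviation cauchy_integrand :: "(complex \<Rightarrow> complex) \<Rightarrow> complex \<Rightarrow> real \<Rightarrow> complex" where
  "cauchy_integrand f z t \<equiv> f (complex_of_real t) / (1 - complex_of_real t * z)"

definition kernel_integral :: "real measure \<Rightarrow> (complex \<Rightarrow> real) \<Rightarrow> real \<Rightarrow> ennreal" where
  "kernel_integral M v r = (\<integral>\<^sup>+ t. ennreal (growth v t / (1 - t * r)) \<partial>M)"

lemma C_vw_finite_iff:
  assumes w: "is_weight w"
  shows "C_vw M v w < \<infinity> \<longleftrightarrow> (\<exists>B\<ge>0. \<forall>r\<in>{0..<1}. kernel_integral M v r \<le> ennreal (B * growth w r))"
proof -
  have le_iff: "ennreal (w (complex_of_real r)) * kernel_integral M v r \<le> ennreal B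
      \<longleftrightarrow> kernel_integral M v r \<le> ennreal (B * growth w r)" if "r \<in> {0..<1}" for r B
  proof -
    let ?w = "w (complex_of_real r)"
    have "0 < ?w" using that by (intro weight_pos[OF w]) simp
    then have "ennreal B = ennreal ?w * ennreal (B * growth w r)"
      by (simp add: growth_def flip: ennreal_mult')
    then show ?thesis using \<open>0 < ?w\<close> by (simp add: ennreal_mult_le_mult_iff)
  qed
  have "C_vw M v w < \<infinity> \<longleftrightarrow> (\<exists>B\<ge>0. C_vw M v w \<le> ennreal B)"
    by (metis ennreal_less_top infinity_ennreal_def le_less_trans less_top_ennreal order_refl)
  moreover have "C_vw M v w =
      (SUP r\<in>{0..<1}. ennreal (w (complex_of_real r)) * kernel_integral M v r)"
    by (simp add: C_vw_def kernel_integral_def growth_def)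
  ultimately show ?thesis by (simp add: SUP_le_iff le_iff)
qed

context
  fixes M :: "real measure" and v w :: "complex \<Rightarrow> real"
  assumes M: "sets M = sets (restrict_space borel {0..<1::real})"
    and v: "is_weight v" and w: "is_weight w"
begin

lemma space_M: "space M = {0..<1}"
  using sets_eq_imp_space_eq[OF M] by (simp add: space_restrict_space)

lemma continuous_on_borel_measurable_M:
  fixes f :: "real \<Rightarrow> 'a::topological_space"
  assumes "continuous_on {0..<1} f"
  shows "f \<in> borel_measurable M"
  using borel_measurable_continuous_on_restrict[OF assms] measurable_cong_sets[OF M refl] by auto

lemma kernel_denominator_pos:
  assumes "t \<in> space M" "norm z < 1"
  shows "0 < 1 - t * norm z"
proof -
  have "t * norm z \<le> 1 * norm z"
    using assms(1) by (intro mult_right_mono) (simp_all add: space_M)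
  then show ?thesis using assms(2) by simp
qed

lemma kernel_denominator_le_norm:
  assumes "t \<in> space M"
  shows "1 - t * norm z \<le> norm (1 - complex_of_real t * z)"
  using norm_triangle_ineq2[of 1 "complex_of_real t * z"] assms by (simp add: norm_mult space_M)

lemma kernel_measurable:
  assumes f: "f holomorphic_on unit_disc" and z: "norm z < 1"
  shows "cauchy_integrand f z \<in> borel_measurable M"
proof (intro continuous_on_borel_measurable_M continuous_intros)
  show "continuous_on {0..<1} (\<lambda>t. f (complex_of_real t))"
    by (rule continuous_on_compose2[OF holomorphic_on_imp_continuous_on[OF f]])
      (auto intro!: continuous_intros)
  show "\<forall>t\<in>{0..<1}. 1 - complex_of_real t * z \<noteq> 0"
    using kernel_denominator_pos[OF _ z] kernel_denominator_le_norm[of _ z] space_M by fastforce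
qed

lemma growth_kernel_measurable [measurable]:
  "(\<lambda>t. growth v t / (1 - t * r)) \<in> borel_measurable M"
proof -
  have [measurable]: "growth v \<in> borel_measurable M"
    by (rule continuous_on_borel_measurable_M[OF growth_continuous_on[OF v]])
  have [measurable]: "(\<lambda>t. t) \<in> borel_measurable M"
    by (intro continuous_on_borel_measurable_M continuous_intros)
  show ?thesis by measurable
qed

lemma norm_kernel_le:
  assumes f: "in_Hv v f" and z: "norm z < 1" and t: "t \<in> space M"
  shows "norm (cauchy_integrand f z t)
     \<le> Hv_norm v f * (growth v t / (1 - t * norm z))"
proof -
  have t01: "0 \<le> t" "t < 1" using t by (simp_all add: space_M)
  have "norm (f (complex_of_real t)) \<le> Hv_norm v f * growth v t"
    using norm_le_Hv_norm_mult_growth[OF v f, of "complex_of_real t"] t01 by simp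
  then have "norm (f (complex_of_real t)) / norm (1 - complex_of_real t * z)
      \<le> Hv_norm v f * growth v t / (1 - t * norm z)"
    using kernel_denominator_pos[OF t z] kernel_denominator_le_norm[OF t]
    by (intro frac_le) (auto intro: order_trans[OF norm_ge_zero])
  then show ?thesis by (simp add: norm_divide)
qed

lemma nn_integral_norm_kernel_le:
  assumes f: "in_Hv v f" and z: "norm z < 1"
  shows "(\<integral>\<^sup>+ t. norm (cauchy_integrand f z t) \<partial>M)
     \<le> ennreal (Hv_norm v f) * kernel_integral M v (norm z)"
proof -
  have "(\<integral>\<^sup>+ t. norm (cauchy_integrand f z t) \<partial>M)
     \<le> (\<integral>\<^sup>+ t. ennreal (Hv_norm v f) * ennreal (growth v t / (1 - t * norm z)) \<partial>M)"
    using norm_kernel_le[OF f z] Hv_norm_nonneg[OF v f]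
    by (intro nn_integral_mono) (simp add: ennreal_mult'[symmetric] ennreal_leI)
  also have "\<dots> = ennreal (Hv_norm v f) * kernel_integral M v (norm z)"
    unfolding kernel_integral_def by (rule nn_integral_cmult) measurable
  finally show ?thesis .
qed

lemma kernel_integrable:
  assumes f: "in_Hv v f" and z: "norm z < 1" and finite: "kernel_integral M v (norm z) < \<infinity>"
  shows "integrable M (cauchy_integrand f z)"
proof (rule integrableI_bounded)
  show "cauchy_integrand f z \<in> borel_measurable M"
    using f z by (intro kernel_measurable) (simp_all add: in_Hv_def)
  have "ennreal (Hv_norm v f) * kernel_integral M v (norm z) < \<infinity>"
    using finite by (simp add: ennreal_mult_less_top)
  with nn_integral_norm_kernel_le[OF f z]
  show "(\<integral>\<^sup>+ t. norm (cauchy_integrand f z t) \<partial>M) < \<infinity>"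
    by (rule le_less_trans)
qed

lemma norm_I_mu_le:
  assumes f: "in_Hv v f" and z: "norm z < 1"
    and B: "0 \<le> B" "kernel_integral M v (norm z) \<le> ennreal B"
  shows "norm (I_mu M f z) \<le> Hv_norm v f * B"
proof -
  have "kernel_integral M v (norm z) < \<infinity>" using B(2) by (rule le_less_trans) simp
  then have "ennreal (norm (I_mu M f z))
      \<le> (\<integral>\<^sup>+ t. norm (cauchy_integrand f z t) \<partial>M)"
    unfolding I_mu_def by (intro integral_norm_bound_ennreal kernel_integrable f z)
  also have "\<dots> \<le> ennreal (Hv_norm v f) * kernel_integral M v (norm z)"
    by (rule nn_integral_norm_kernel_le[OF f z])
  also have "\<dots> \<le> ennreal (Hv_norm v f) * ennreal B" by (intro mult_left_mono B) simp
  also have "\<dots> = ennreal (Hv_norm v f * B)"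
    using Hv_norm_nonneg[OF v f] B(1) by (simp add: ennreal_mult)
  finally show ?thesis
    using Hv_norm_nonneg[OF v f] B(1) by (simp add: ennreal_le_iff)
qed

lemma I_mu_holomorphic:
  assumes f: "integrable M (\<lambda>t. f (complex_of_real t))"
  shows "I_mu M f holomorphic_on unit_disc"
proof (rule power_series_holomorphic)
  fix z :: complex assume z: "z \<in> unit_disc"
  have "(\<lambda>n. \<integral>t. f (complex_of_real t) * (complex_of_real t * z) ^ n \<partial>M) sums I_mu M f z"
    unfolding I_mu_def
  proof (rule sums_integral_geometric[OF f])
    show "(\<lambda>t. complex_of_real t * z) \<in> borel_measurable M"
      by (intro continuous_on_borel_measurable_M continuous_intros)
    show "norm (complex_of_real t * z) \<le> norm z" if "t \<in> space M" for t
      using that by (simp add: space_M norm_mult mult_left_le_one_le)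
  qed (use z in simp_all)
  then show "(\<lambda>n. (\<integral>t. f (complex_of_real t) * complex_of_real t ^ n \<partial>M) * (z - 0) ^ n)
      sums I_mu M f z"
    by (simp add: power_mult_distrib flip: mult.assoc)
qed

lemma I_mu_bounded_if_C_vw_finite:
  assumes "C_vw M v w < \<infinity>"
  shows "I_mu_bounded M v w"
proof -
  obtain B where "0 \<le> B"
    and kernel_le: "\<And>r. r \<in> {0..<1} \<Longrightarrow> kernel_integral M v r \<le> ennreal (B * growth w r)"
    using assms C_vw_finite_iff[OF w] by blast
  have integrable: "integrable M (cauchy_integrand f z)"
    if "in_Hv v f" "norm z < 1" for f z
    using that kernel_le[of "norm z"] by (intro kernel_integrable) (auto intro: le_less_trans)
  have "in_Hv w (I_mu M f) \<and> Hv_norm w (I_mu M f) \<le> B * Hv_norm v f" if f: "in_Hv v f" for f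
  proof -
    have holomorphic: "I_mu M f holomorphic_on unit_disc"
      using integrable[OF f, of 0] by (intro I_mu_holomorphic) simp
    have "norm (I_mu M f z) \<le> B * Hv_norm v f * growth w (norm z)" if z: "norm z < 1" for z
      using norm_I_mu_le[OF f z _ kernel_le] \<open>0 \<le> B\<close> growth_pos[OF w, of "norm z"] z
      by (simp add: mult_ac)
    from in_Hv_if_norm_le_growth[OF w holomorphic this] show ?thesis by simp
  qed
  then show ?thesis unfolding I_mu_bounded_def using integrable by auto
qed

lemma kernel_integral_le_Re_I_mu:
  assumes growth_le: "\<And>t. 0 \<le> t \<Longrightarrow> t < 1 \<Longrightarrow> growth v t \<le> Re (F (complex_of_real t))"
    and r: "0 \<le> r" "r < 1"
    and int: "integrable M (cauchy_integrand F (complex_of_real r))"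
  shows "kernel_integral M v r \<le> ennreal (Re (I_mu M F (complex_of_real r)))"
proof -
  let ?k = "cauchy_integrand F (complex_of_real r)"
  have growth_kernel: "0 \<le> growth v t / (1 - t * r)" "growth v t / (1 - t * r) \<le> Re (?k t)"
    if t: "t \<in> space M" for t
  proof -
    have "0 < 1 - t * r" using kernel_denominator_pos[OF t, of "complex_of_real r"] r by simp
    moreover have "1 - complex_of_real t * complex_of_real r = complex_of_real (1 - t * r)"
      by simp
    then have "Re (?k t) = Re (F (complex_of_real t)) / (1 - t * r)"
      by (simp only: Re_divide_of_real)
    ultimately show "0 \<le> growth v t / (1 - t * r)" "growth v t / (1 - t * r) \<le> Re (?k t)"
      using growth_le[of t] growth_pos[OF v, of t] t by (simp_all add: space_M divide_right_mono)
  qed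
  have "kernel_integral M v r \<le> (\<integral>\<^sup>+ t. ennreal (Re (?k t)) \<partial>M)"
    unfolding kernel_integral_def using growth_kernel by (intro nn_integral_mono ennreal_leI)
  also have "\<dots> = ennreal (\<integral>t. Re (?k t) \<partial>M)"
    using int order_trans[OF growth_kernel]
    by (intro nn_integral_eq_integral integrable_Re AE_I2) auto
  also have "(\<integral>t. Re (?k t) \<partial>M) = Re (I_mu M F (complex_of_real r))"
    unfolding I_mu_def using int by (rule integral_Re)
  finally show ?thesis .
qed

lemma C_vw_finite_if_I_mu_bounded:
  assumes "essential_weight v" and bounded: "I_mu_bounded M v w"
  shows "C_vw M v w < \<infinity>"
proof -
  obtain F where F: "in_Hv v F"
    and growth_le: "\<And>t. 0 \<le> t \<Longrightarrow> t < 1 \<Longrightarrow> growth v t \<le> Re (F (complex_of_real t))"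
    using essential_weight_test_function[OF v \<open>essential_weight v\<close>] by blast
  have IF: "in_Hv w (I_mu M F)" using bounded F by (simp add: I_mu_bounded_def)
  have "kernel_integral M v r \<le> ennreal (Hv_norm w (I_mu M F) * growth w r)"
    if r: "r \<in> {0..<1}" for r
  proof -
    have "kernel_integral M v r \<le> ennreal (Re (I_mu M F (complex_of_real r)))"
      using bounded F growth_le r
      by (intro kernel_integral_le_Re_I_mu) (simp_all add: I_mu_bounded_def)
    also have "Re (I_mu M F (complex_of_real r)) \<le> norm (I_mu M F (complex_of_real r))"
      by (rule complex_Re_le_cmod)
    also have "\<dots> \<le> Hv_norm w (I_mu M F) * growth w r"
      using norm_le_Hv_norm_mult_growth[OF w IF, of "complex_of_real r"] r by simp
    finally show ?thesis by (simp add: ennreal_leI)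
  qed
  then show ?thesis using C_vw_finite_iff[OF w] Hv_norm_nonneg[OF w IF] by blast
qed

end

theorem theorem8:
  fixes M :: "real measure" and v w :: "complex \<Rightarrow> real"
  assumes "sets M = sets (restrict_space borel {0..<1::real})"
    and "finite_measure M"
    and "is_weight v" and "is_weight w"
  shows "(C_vw M v w < \<infinity> \<longrightarrow> I_mu_bounded M v w) \<and>
         (essential_weight v \<longrightarrow> (C_vw M v w < \<infinity> \<longleftrightarrow> I_mu_bounded M v w))"
  using I_mu_bounded_if_C_vw_finite[OF assms(1,3,4)] C_vw_finite_if_I_mu_bounded[OF assms(1,3,4)]
  by blast

end
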